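(* Let $T\in\mathbf{B}(H)$ be left-invertible and analytic. Assume that $A\in\mathbf{B}(H)$ commutes with $T$. Let $\hat\varphi_A\colon\mathbb{N}_0\to\mathbf{B}(\mathcal{E})$ be given by $\hat\varphi_A(m)=P_{\mathcal{E}}L^mA|_{\mathcal{E}}$ for $m\in\mathbb{N}_0$. Then $\hat\varphi_A\in\mathcal{GM}(T)$ and $A=U^*M_{\hat\varphi_A}U$.
   Context: $\mathbb{N}_0=\{0,1,2,\dots\}$. $H$ is a nonzero complex Hilbert space and $\mathbf{B}(H)$ is the algebra of bounded operators on it. $T\in\mathbf{B}(H)$ is left-invertible if $AT=I$ for some $A\in\mathbf{B}(H)$, and analytic if $\bigcap_{n=0}^\infty T^n(H)=\{0\}$. For left-invertible analytic $T$ put $\mathcal{E}=\ker T^*$, let $P_{\mathcal{E}}$ be the orthogonal projection of $H$ onto $\mathcal{E}$, $L=(T^*T)^{-1}T^*$ (the adjoint of the Cauchy dual $T'=T(T^*T)^{-1}$), $r=1/r(L)$ with $r(L)$ the spectral radius of $L$, and $\mathbb{D}_r=\{z\in\mathbb{C}:|z|<r\}$. For $f\in H$ let $(Uf)(z)=\sum_{n=0}^\infty (P_{\mathcal{E}}L^nf)z^n$, $z\in\mathbb{D}_r$; $U$ is an injective linear map from $H$ into the space of $\mathcal{E}$-valued analytic functions on $\mathbb{D}_r$ (Shimorin's model). $\mathcal{H}:=U(H)$ carries the inner product making $U\colon H\to\mathcal{H}$ unitary. For $\boldsymbol f\in\mathcal{H}$, $\hat{\boldsymbol f}(n)=P_{\mathcal{E}}L^nU^*\boldsymbol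 f$ ($n\in\mathbb{N}_0$) are its Taylor coefficients. For $\hat\varphi\colon\mathbb{N}_0\to\mathbf{B}(\mathcal{E})$ and $\hat f\colon\mathbb{N}_0\to\mathcal{E}$, $(\hat\varphi*\hat f)(n)=\sum_{k=0}^n\hat\varphi(k)\hat f(n-k)$. The multiplication operator $M_{\hat\varphi}$ in $\mathcal{H}$ has domain consisting of those $\boldsymbol f\in\mathcal{H}$ for which there is (a necessarily unique) $\boldsymbol g\in\mathcal{H}$ with $\hat\varphi*\hat{\boldsymbol f}=\hat{\boldsymbol g}$, and $M_{\hat\varphi}\boldsymbol f=\boldsymbol g$. $\hat\varphi$ is a generalized multiplier of $T$ if the domain of $M_{\hat\varphi}$ is all of $\mathcal{H}$ (then $M_{\hat\varphi}\in\mathbf{B}(\mathcal{H})$). $\mathcal{GM}(T)$ is the set of all generalized multipliers of $T$. *)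

theory Defs
  imports "HOL-Analysis.Analysis" "HOL-Library.FuncSet"
begin

section \<open>Complex Hilbert spaces\<close>

class complex_vector = real_vector +
  fixes scaleC :: "complex \<Rightarrow> 'a \<Rightarrow> 'a"  (infixr "*\<^sub>C" 75)
  assumes scaleC_add_right: "c *\<^sub>C (x + y) = c *\<^sub>C x + c *\<^sub>C y"
    and scaleC_add_left: "(c + d) *\<^sub>C x = c *\<^sub>C x + d *\<^sub>C x"
    and scaleC_scaleC: "c *\<^sub>C d *\<^sub>C x = (c * d) *\<^sub>C x"
    and scaleC_one: "1 *\<^sub>C x = x"
    and scaleR_scaleC: "t *\<^sub>R x = complex_of_real t *\<^sub>C x"

class complex_inner = complex_vector + real_normed_vector +
  fixes cinner :: "'a \<Rightarrow> 'a \<Rightarrow> complex"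
  assumes cinner_commute: "cinner x y = cnj (cinner y x)"
    and cinner_add_left: "cinner (x + y) z = cinner x z + cinner y z"
    and cinner_scaleC_left: "cinner (c *\<^sub>C x) y = c * cinner x y"
    and cinner_ge_zero: "0 \<le> Re (cinner x x)"
    and cinner_eq_zero_iff: "cinner x x = 0 \<longleftrightarrow> x = 0"
    and norm_eq_sqrt_cinner: "norm x = sqrt (Re (cinner x x))"

class complex_hilbert = complex_inner + complete_space


section \<open>Operators\<close>

definition bounded_ops :: "('a::complex_hilbert \<Rightarrow> 'a) set" where
  "bounded_ops = {S. bounded_linear S \<and> (\<forall>c x. S (c *\<^sub>C x) = c *\<^sub>C S x)}"

text \<open>
  Bounded operators on a closed subspace \<open>M\<close>. A map from \<open>M\<close> to \<open>M\<close> is represented by a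
  function on the whole type that is \<^const>\<open>undefined\<close> off \<open>M\<close>, so that each operator on \<open>M\<close>
  has exactly one representative.
\<close>

definition bounded_ops_on :: "'a::complex_hilbert set \<Rightarrow> ('a \<Rightarrow> 'a) set" where
  "bounded_ops_on M = {S \<in> M \<rightarrow>\<^sub>E M.
     (\<forall>x\<in>M. \<forall>y\<in>M. S (x + y) = S x + S y) \<and>
     (\<forall>c. \<forall>x\<in>M. S (c *\<^sub>C x) = c *\<^sub>C S x) \<and>
     (\<exists>K. \<forall>x\<in>M. norm (S x) \<le> K * norm x)}"

definition hadjoint :: "('a::complex_hilbert \<Rightarrow> 'a) \<Rightarrow> 'a \<Rightarrow> 'a" where
  "hadjoint S = (THE S'. \<forall>x y. cinner (S x) y = cinner x (S' y))"

definition orth_proj :: "'a::complex_hilbert set \<Rightarrow> 'a \<Rightarrow> 'a" where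
  "orth_proj M x = (THE y. y \<in> M \<and> (\<forall>m\<in>M. cinner (x - y) m = 0))"

definition op_spectrum :: "('a::complex_hilbert \<Rightarrow> 'a) \<Rightarrow> complex set" where
  "op_spectrum S = {c. \<not> (\<exists>R\<in>bounded_ops. R \<circ> (\<lambda>x. S x - c *\<^sub>C x) = id
                                        \<and> (\<lambda>x. S x - c *\<^sub>C x) \<circ> R = id)}"

definition spectral_radius :: "('a::complex_hilbert \<Rightarrow> 'a) \<Rightarrow> real" where
  "spectral_radius S = Sup (cmod ` op_spectrum S)"

definition left_invertible :: "('a::complex_hilbert \<Rightarrow> 'a) \<Rightarrow> bool" where
  "left_invertible T \<longleftrightarrow> (\<exists>A\<in>bounded_ops. A \<circ> T = id)"

definition analytic_op :: "('a::complex_hilbert \<Rightarrow> 'a) \<Rightarrow> bool" where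
  "analytic_op T \<longleftrightarrow> (\<Inter>n::nat. range (T ^^ n)) = {0}"


section \<open>Shimorin's analytic model\<close>

text \<open>The definitions below are meaningful for left-invertible analytic \<open>T\<close>.\<close>

definition ker_adj :: "('a::complex_hilbert \<Rightarrow> 'a) \<Rightarrow> 'a set" where
  "ker_adj T = {x. hadjoint T x = 0}"

definition proj_E :: "('a::complex_hilbert \<Rightarrow> 'a) \<Rightarrow> 'a \<Rightarrow> 'a" where
  "proj_E T = orth_proj (ker_adj T)"

definition left_inv :: "('a::complex_hilbert \<Rightarrow> 'a) \<Rightarrow> 'a \<Rightarrow> 'a" where
  "left_inv T = inv (hadjoint T \<circ> T) \<circ> hadjoint T"

definition model_radius :: "('a::complex_hilbert \<Rightarrow> 'a) \<Rightarrow> real" where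
  "model_radius T = 1 / spectral_radius (left_inv T)"

definition model_U :: "('a::complex_hilbert \<Rightarrow> 'a) \<Rightarrow> 'a \<Rightarrow> complex \<Rightarrow> 'a" where
  "model_U T f = (\<lambda>z\<in>ball 0 (model_radius T). \<Sum>n. z ^ n *\<^sub>C proj_E T ((left_inv T ^^ n) f))"

definition model_space :: "('a::complex_hilbert \<Rightarrow> 'a) \<Rightarrow> (complex \<Rightarrow> 'a) set" where
  "model_space T = range (model_U T)"

text \<open>The inner product of the model space, transported along the injective map \<open>model_U T\<close>.\<close>

definition model_inner ::
  "('a::complex_hilbert \<Rightarrow> 'a) \<Rightarrow> (complex \<Rightarrow> 'a) \<Rightarrow> (complex \<Rightarrow> 'a) \<Rightarrow> complex" where
  "model_inner T F G = cinner (inv (model_U T) F) (inv (model_U T) G)"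

definition model_U_adj :: "('a::complex_hilbert \<Rightarrow> 'a) \<Rightarrow> (complex \<Rightarrow> 'a) \<Rightarrow> 'a" where
  "model_U_adj T G = (THE g. \<forall>f. model_inner T (model_U T f) G = cinner f g)"

definition taylor_coeff :: "('a::complex_hilbert \<Rightarrow> 'a) \<Rightarrow> (complex \<Rightarrow> 'a) \<Rightarrow> nat \<Rightarrow> 'a" where
  "taylor_coeff T F n = proj_E T ((left_inv T ^^ n) (model_U_adj T F))"


section \<open>Generalized multipliers\<close>

definition conv :: "(nat \<Rightarrow> 'a \<Rightarrow> 'a) \<Rightarrow> (nat \<Rightarrow> 'a) \<Rightarrow> nat \<Rightarrow> 'a::complex_hilbert" where
  "conv \<phi> f n = (\<Sum>k\<le>n. \<phi> k (f (n - k)))"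

definition mult_dom ::
  "('a::complex_hilbert \<Rightarrow> 'a) \<Rightarrow> (nat \<Rightarrow> 'a \<Rightarrow> 'a) \<Rightarrow> (complex \<Rightarrow> 'a) set" where
  "mult_dom T \<phi> = {F \<in> model_space T.
     \<exists>G\<in>model_space T. conv \<phi> (taylor_coeff T F) = taylor_coeff T G}"

definition mult_op ::
  "('a::complex_hilbert \<Rightarrow> 'a) \<Rightarrow> (nat \<Rightarrow> 'a \<Rightarrow> 'a) \<Rightarrow> (complex \<Rightarrow> 'a) \<Rightarrow> complex \<Rightarrow> 'a" where
  "mult_op T \<phi> F = (THE G. G \<in> model_space T \<and> conv \<phi> (taylor_coeff T F) = taylor_coeff T G)"

definition generalized_multipliers ::
  "('a::complex_hilbert \<Rightarrow> 'a) \<Rightarrow> (nat \<Rightarrow> 'a \<Rightarrow> 'a) set" where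
  "generalized_multipliers T =
     {\<phi>. (\<forall>n. \<phi> n \<in> bounded_ops_on (ker_adj T)) \<and> mult_dom T \<phi> = model_space T}"

definition commutant_symbol ::
  "('a::complex_hilbert \<Rightarrow> 'a) \<Rightarrow> ('a \<Rightarrow> 'a) \<Rightarrow> nat \<Rightarrow> 'a \<Rightarrow> 'a" where
  "commutant_symbol T A m = restrict (proj_E T \<circ> (left_inv T ^^ m) \<circ> A) (ker_adj T)"

end

theory Submission
  imports Defs "HOL-Complex_Analysis.Cauchy_Integral_Formula"
begin

text \<open>
  Since \<open>L T = I\<close> and \<open>P = I - T L\<close> is the projection onto \<open>\<E> = ker T\<^sup>*\<close>, commutation of \<open>A\<close>
  with \<open>T\<close> gives \<open>L\<^sup>k A P = L\<^sup>k A - L\<^sup>k\<^sup>-\<^sup>1 A L\<close> for \<open>k \<ge> 1\<close> and \<open>P A P = P A\<close>. The Cauchy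
  product of the symbol of \<open>A\<close> with the Taylor coefficients of \<open>U f\<close> therefore telescopes to
  \<open>P L\<^sup>n A f\<close>, the \<open>n\<close>-th Taylor coefficient of \<open>U (A f)\<close>. Injectivity of \<open>U\<close> follows from the
  identity theorem for power series and \<open>f = T\<^sup>n L\<^sup>n f + (\<Sum>k<n. T\<^sup>k P L\<^sup>k f)\<close>, once the radius of the
  model is known to be positive.
\<close>

\<comment> \<open>Makes Banach space results available: the minimization argument and the comparison
  test for series below need them.\<close>
subclass (in complex_hilbert) banach ..

section \<open>Inner product and coercive forms\<close>

lemma cinner_add_right: "cinner x (y + z) = cinner x y + cinner x (z::'a::complex_inner)"
  by (metis cinner_commute cinner_add_left complex_cnj_add)

lemma cinner_scaleC_right: "cinner x (c *\<^sub>C y) = cnj c * cinner x (y::'a::complex_inner)"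
  by (metis cinner_commute cinner_scaleC_left complex_cnj_mult)

lemma cinner_self: "cinner x x = complex_of_real ((norm (x::'a::complex_inner))\<^sup>2)"
proof -
  have "Im (cinner x x) = 0"
    using arg_cong[OF cinner_commute[of x x], of Im] by simp
  then show ?thesis
    by (simp add: complex_eq_iff norm_eq_sqrt_cinner cinner_ge_zero)
qed

lemma norm_scaleC: "norm (c *\<^sub>C x) = cmod c * norm (x::'a::complex_inner)"
proof -
  have "complex_of_real ((norm (c *\<^sub>C x))\<^sup>2) = complex_of_real ((cmod c * norm x)\<^sup>2)"
    unfolding cinner_self[symmetric] cinner_scaleC_left cinner_scaleC_right
    using complex_norm_square[of c] by (simp add: cinner_self power_mult_distrib mult.commute)
  then show ?thesis
    by (metis of_real_eq_iff power2_eq_iff_nonneg mult_nonneg_nonneg norm_ge_zero)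
qed

lemma scaleC_minus1: "(- 1) *\<^sub>C x = - (x::'a::complex_vector)"
  using scaleR_scaleC[of "-1" x] by simp

lemma scaleC_minus_right: "c *\<^sub>C (- x) = - (c *\<^sub>C (x::'a::complex_vector))"
  by (simp add: scaleC_scaleC flip: scaleC_minus1)

lemma scaleC_diff_right: "c *\<^sub>C (x - y) = c *\<^sub>C x - c *\<^sub>C (y::'a::complex_vector)"
  using scaleC_add_right[of c x "-y"] by (simp add: scaleC_minus_right)

lemma scaleC_scaleR_commute: "c *\<^sub>C (t *\<^sub>R x) = t *\<^sub>R (c *\<^sub>C (x::'a::complex_vector))"
  by (simp add: scaleR_scaleC scaleC_scaleC mult.commute)

lemma bounded_linear_scaleC: "bounded_linear (\<lambda>x::'a::complex_inner. c *\<^sub>C x)"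
  by (rule bounded_linear_intro[where K = "cmod c"])
     (simp_all add: scaleC_add_right scaleC_scaleR_commute norm_scaleC mult.commute)

lemma cinner_Cauchy_Schwarz: "cmod (cinner x y) \<le> norm x * norm (y::'a::complex_inner)"
proof (cases "y = 0")
  case True
  have "cinner x (0::'a) = 0"
    using cinner_add_right[of x 0 0] by simp
  then show ?thesis
    using True by simp
next
  case False
  \<comment> \<open>This \<open>c\<close> makes \<open>x + c *\<^sub>C y\<close> orthogonal to
    \<open>y\<close>, hence as short as possible; nonnegativity of its squared norm is then the
    sharp inequality.\<close>
  define c where "c = - cinner x y / (norm y)\<^sup>2"
  have "0 \<le> Re (cinner (x + c *\<^sub>C y) (x + c *\<^sub>C y))"
    by (rule cinner_ge_zero)
  also have "cinner (x + c *\<^sub>C y) (x + c *\<^sub>C y) =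
      (norm x)\<^sup>2 + cnj c * cinner x y + c * cnj (cinner x y) + c * cnj c * (norm y)\<^sup>2"
    by (simp add: cinner_add_left cinner_add_right cinner_scaleC_left cinner_scaleC_right
        cinner_self[of x] cinner_self[of y] cinner_commute[of y x] algebra_simps)
  also have "\<dots> = (norm x)\<^sup>2 - cinner x y * cnj (cinner x y) / (norm y)\<^sup>2"
    using False by (simp add: c_def field_simps power2_eq_square)
  also have "\<dots> = complex_of_real ((norm x)\<^sup>2 - (cmod (cinner x y))\<^sup>2 / (norm y)\<^sup>2)"
    by (simp flip: complex_norm_square)
  finally have "(cmod (cinner x y))\<^sup>2 \<le> (norm x * norm y)\<^sup>2"
    using False by (simp add: field_simps power_mult_distrib)
  then show ?thesis
    by (rule power2_le_imp_le) simp
qed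

interpretation cinner: bounded_bilinear "cinner :: 'a::complex_inner \<Rightarrow> 'a \<Rightarrow> complex"
proof
  show "\<exists>K. \<forall>a b::'a. norm (cinner a b) \<le> norm a * norm b * K"
    by (intro exI[of _ 1]) (simp add: cinner_Cauchy_Schwarz)
qed (simp_all add: cinner_add_left cinner_add_right scaleR_scaleC cinner_scaleC_left
       cinner_scaleC_right scaleR_conv_of_real)

lemma bounded_bilinear_Re_cinner:
  "bounded_bilinear (\<lambda>x y::'a::complex_inner. Re (cinner x y))"
proof
  show "\<exists>K. \<forall>a b::'a. norm (Re (cinner a b)) \<le> norm a * norm b * K"
    by (intro exI[of _ 1]) (simp add: order_trans[OF abs_Re_le_cmod cinner_Cauchy_Schwarz])
qed (simp_all add: cinner.add_left cinner.add_right cinner.scaleR_left cinner.scaleR_right)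

lemma cinner_eqI:
  fixes x y :: "'a::complex_inner"
  assumes "\<And>h. cinner h x = cinner h y"
  shows "x = y"
proof -
  have "cinner (x - y) (x - y) = 0"
    using assms[of "x - y"] by (simp add: cinner.diff_right)
  then show ?thesis
    by (simp add: cinner_eq_zero_iff)
qed

section \<open>Minimization of coercive quadratic functionals\<close>

lemma nonneg_quadratic_imp_linear_coeff_zero:
  fixes a b :: real
  assumes "\<And>t. 0 \<le> t\<^sup>2 * a + t * b"
  shows "b = 0"
proof -
  have a: "0 \<le> a"
    using assms[of 1] assms[of "-1"] by simp
  \<comment> \<open>The chosen \<open>t\<close> gives a negative value unless \<open>b = 0\<close>,
    and its denominator stays positive even for \<open>a = 0\<close>.\<close>
  have "0 \<le> (- b / (a + 1))\<^sup>2 * a + (- b / (a + 1)) * b"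
    by (rule assms)
  also have "\<dots> = - (b / (a + 1))\<^sup>2"
    using a by (simp add: divide_simps) (simp add: power2_eq_square algebra_simps)
  finally have "(b / (a + 1))\<^sup>2 \<le> 0"
    by simp
  then show ?thesis
    using a by simp
qed

text \<open>Symmetric Lax-Milgram by the direct method: a minimizing sequence of \<open>J\<close> is
  Cauchy, and the first variation of \<open>J\<close> vanishes at its limit. It later supplies both
  adjoints and the surjectivity of T*T.\<close>

lemma coercive_form_represents:
  fixes B :: "'a::banach \<Rightarrow> 'a \<Rightarrow> real" and \<phi> :: "'a \<Rightarrow> real"
  assumes B: "bounded_bilinear B" and sym: "\<And>x y. B x y = B y x"
    and c: "0 < c" and coercive: "\<And>x. c * (norm x)\<^sup>2 \<le> B x x"
    and \<phi>: "bounded_linear \<phi>"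
  obtains x where "\<And>h. B h x = \<phi> h"
proof -
  interpret B: bounded_bilinear B by (rule B)
  interpret \<phi>: bounded_linear \<phi> by (rule \<phi>)
  define J where "J x = B x x - 2 * \<phi> x" for x
  define d where "d = Inf (range J)"
  obtain K where K: "\<And>x. norm (\<phi> x) \<le> norm x * K"
    using \<phi>.bounded by blast
  have J_ge: "- K\<^sup>2 / c \<le> J x" for x
  proof -
    \<comment> \<open>Completing the square bounds \<open>J\<close> below, so that the infimum
      \<open>d\<close> is meaningful.\<close>
    have "0 \<le> (c * norm x - K)\<^sup>2 / c"
      using c by simp
    also have "\<dots> = c * (norm x)\<^sup>2 - 2 * (norm x * K) + K\<^sup>2 / c"
      using c by (simp add: field_simps power2_eq_square)
    also have "\<dots> \<le> J x + K\<^sup>2 / c"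
      using coercive[of x] K[of x] unfolding J_def by simp
    finally show ?thesis by simp
  qed
  have bdd: "bdd_below (range J)"
    using J_ge by (intro bdd_belowI[of _ "- K\<^sup>2 / c"]) auto
  have d_le: "d \<le> J x" for x
    unfolding d_def using bdd by (rule cInf_lower[rotated]) simp
  have "\<exists>x. J x < d + inverse (real (Suc n))" for n
  proof -
    have "Inf (range J) < d + inverse (real (Suc n))"
      unfolding d_def by simp
    then show ?thesis
      using cInf_lessD[of "range J"] by blast
  qed
  then obtain X where X: "\<And>n. J (X n) < d + inverse (real (Suc n))"
    by metis
  \<comment> \<open>The linear terms cancel. Since \<open>J\<close> at the midpoint is at least
    \<open>d\<close>, two near-minimizers must be close to each other.\<close>
  have parallelogram: "B (x - y) (x - y) = 2 * J x + 2 * J y - 4 * J ((1/2) *\<^sub>R (x + y))" for x y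
    unfolding J_def
    by (simp add: B.add_left B.add_right B.diff_left B.diff_right B.scaleR_left B.scaleR_right
        \<phi>.add \<phi>.scaleR sym[of y x] algebra_simps)
  have close: "c * (norm (X m - X n))\<^sup>2 \<le> 2 * inverse (real (Suc m)) + 2 * inverse (real (Suc n))"
    for m n
    using coercive[of "X m - X n"] parallelogram[of "X m" "X n"] X[of m] X[of n]
      d_le[of "(1/2) *\<^sub>R (X m + X n)"] by linarith
  have "Cauchy X"
  proof (rule CauchyI)
    fix e :: real assume e: "0 < e"
    then obtain N where N: "inverse (real (Suc N)) < c * e\<^sup>2 / 4"
      using reals_Archimedean[of "c * e\<^sup>2 / 4"] c by auto
    show "\<exists>M. \<forall>m\<ge>M. \<forall>n\<ge>M. norm (X m - X n) < e"
    proof (intro exI allI impI)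
      fix m n assume mn: "N \<le> m" "N \<le> n"
      have "inverse (real (Suc m)) \<le> inverse (real (Suc N))"
        "inverse (real (Suc n)) \<le> inverse (real (Suc N))"
        using mn by (simp_all add: le_imp_inverse_le)
      then have "c * (norm (X m - X n))\<^sup>2 < c * e\<^sup>2"
        using close[of m n] N by linarith
      then have "(norm (X m - X n))\<^sup>2 < e\<^sup>2"
        using c by simp
      then show "norm (X m - X n) < e"
        using e by (simp add: power_less_imp_less_base)
    qed
  qed
  then obtain x where x: "X \<longlonglongrightarrow> x"
    using Cauchy_convergent convergent_def by blast
  have "(\<lambda>n. J (X n)) \<longlonglongrightarrow> J x"
    unfolding J_def by (intro tendsto_intros B.tendsto \<phi>.tendsto x)
  moreover have "(\<lambda>n. d + inverse (real (Suc n))) \<longlonglongrightarrow> d + 0"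
    by (intro tendsto_intros LIMSEQ_inverse_real_of_nat)
  ultimately have "J x \<le> d + 0"
    by (rule LIMSEQ_le) (use X less_imp_le in blast)
  then have min: "J x \<le> J y" for y
    using d_le[of y] by simp
  have "B h x = \<phi> h" for h
  proof -
    have "0 \<le> t\<^sup>2 * B h h + t * (2 * (B h x - \<phi> h))" for t
    proof -
      have "J (x + t *\<^sub>R h) - J x = t\<^sup>2 * B h h + t * (2 * (B h x - \<phi> h))"
        unfolding J_def
        by (simp add: B.add_left B.add_right B.scaleR_left B.scaleR_right \<phi>.add \<phi>.scaleR
            sym[of x h] power2_eq_square algebra_simps)
      then show ?thesis
        using min[of "x + t *\<^sub>R h"] by simp
    qed
    from nonneg_quadratic_imp_linear_coeff_zero[OF this] show ?thesis by simp
  qed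
  then show thesis by (rule that)
qed

section \<open>Bounded operators\<close>

lemma bounded_opsD:
  assumes "S \<in> bounded_ops"
  shows "bounded_linear S" "S (c *\<^sub>C x) = c *\<^sub>C S x"
  using assms by (auto simp: bounded_ops_def)

lemma bounded_ops_comp:
  assumes "R \<in> bounded_ops" "S \<in> bounded_ops"
  shows "(\<lambda>x. R (S x)) \<in> bounded_ops"
  using assms by (auto simp: bounded_ops_def intro: bounded_linear_compose)

lemma bounded_ops_diff:
  assumes "R \<in> bounded_ops" "S \<in> bounded_ops"
  shows "(\<lambda>x. R x - S x) \<in> bounded_ops"
  using assms by (auto simp: bounded_ops_def scaleC_diff_right intro: bounded_linear_sub)

lemma bounded_ops_id: "(\<lambda>x. x) \<in> bounded_ops"
  by (simp add: bounded_ops_def)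

lemma bounded_ops_scaleC: "(\<lambda>x. c *\<^sub>C x) \<in> bounded_ops"
  by (simp add: bounded_ops_def bounded_linear_scaleC scaleC_scaleC mult.commute)

lemma bounded_ops_funpow:
  assumes "S \<in> bounded_ops"
  shows "S ^^ n \<in> bounded_ops"
proof (induction n)
  case 0
  show ?case by (simp add: id_def bounded_ops_id)
next
  case (Suc n)
  then show ?case using bounded_ops_comp[OF assms Suc] by (simp add: o_def)
qed

lemma bounded_ops_inv:
  assumes S: "S \<in> bounded_ops" and bij: "bij S"
    and c: "0 < c" and below: "\<And>x. c * norm x \<le> norm (S x)"
  shows "inv S \<in> bounded_ops"
proof -
  interpret S: bounded_linear S by (rule bounded_opsD[OF S])
  have inv: "S (inv S y) = y" for y
    using bij by (simp add: bij_is_surj surj_f_inv_f)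
  have eqI: "inv S y = x" if "S x = y" for x y
    using bij that by (metis bij_inv_eq_iff)
  show ?thesis
    unfolding bounded_ops_def
  proof (intro CollectI conjI allI)
    show "bounded_linear (inv S)"
    proof (rule bounded_linear_intro[where K = "inverse c"])
      show "norm (inv S y) \<le> norm y * inverse c" for y
        using below[of "inv S y"] c by (simp add: inv field_simps)
    qed (intro eqI, simp add: S.add S.scaleR inv)+
    show "inv S (a *\<^sub>C x) = a *\<^sub>C inv S x" for a x
      by (intro eqI) (simp add: bounded_opsD(2)[OF S] inv)
  qed
qed

text \<open>Solving \<open>S x - c *\<^sub>C x = y\<close> is a fixed point problem for a map with
  Lipschitz constant \<open>K / cmod c < 1\<close>. Bijectivity will be applied to \<open>T\<close>
  to build an eigenvector of \<open>L\<close>, the spectral bound to \<open>L\<close>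
  itself.\<close>

lemma bounded_ops_shift:
  assumes S: "S \<in> bounded_ops" and K: "\<And>x. norm (S x) \<le> K * norm x" and c: "K < cmod c"
    and K0: "0 \<le> K"
  shows "bij (\<lambda>x. S x - c *\<^sub>C x)" "c \<notin> op_spectrum S"
proof -
  interpret S: bounded_linear S by (rule bounded_opsD[OF S])
  have c0: "c \<noteq> 0" using c K0 by auto
  let ?D = "\<lambda>x. S x - c *\<^sub>C x"
  have D: "?D \<in> bounded_ops"
    by (intro bounded_ops_diff S bounded_ops_scaleC)
  interpret D: bounded_linear ?D by (rule bounded_opsD[OF D])
  have below: "(cmod c - K) * norm x \<le> norm (?D x)" for x
    using norm_triangle_ineq3[of "S x" "c *\<^sub>C x"] K[of x]
    by (simp add: norm_scaleC algebra_simps)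
  have "inj ?D"
    unfolding linear_injective_0[OF D.linear]
  proof (intro allI impI)
    fix x assume "?D x = 0"
    then have "(cmod c - K) * norm x \<le> 0"
      using below[of x] by simp
    then show "x = 0"
      using c by (simp add: mult_le_0_iff)
  qed
  moreover have "surj ?D"
    unfolding surj_def
  proof
    fix y
    have "\<exists>!x. inverse c *\<^sub>C (S x - y) = x"
    proof (rule banach_fix_type[where c = "K / cmod c"])
      show "\<forall>u v. dist (inverse c *\<^sub>C (S u - y)) (inverse c *\<^sub>C (S v - y)) \<le> K / cmod c * dist u v"
      proof (intro allI)
        fix u v
        have "dist (inverse c *\<^sub>C (S u - y)) (inverse c *\<^sub>C (S v - y)) = norm (S (u - v)) / cmod c"
          by (simp add: dist_norm norm_scaleC norm_inverse S.diff divide_inverse mult.commute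
              flip: scaleC_diff_right)
        also have "\<dots> \<le> K / cmod c * dist u v"
          using divide_right_mono[OF K[of "u - v"], of "cmod c"] by (simp add: dist_norm)
        finally show "dist (inverse c *\<^sub>C (S u - y)) (inverse c *\<^sub>C (S v - y)) \<le> K / cmod c * dist u v" .
      qed
    qed (use c K0 c0 in auto)
    then obtain x where "inverse c *\<^sub>C (S x - y) = x"
      by blast
    then have "c *\<^sub>C x = c *\<^sub>C inverse c *\<^sub>C (S x - y)"
      by simp
    then have "c *\<^sub>C x = S x - y"
      using c0 by (simp add: scaleC_scaleC scaleC_one)
    then show "\<exists>x. y = ?D x"
      by (intro exI[of _ x]) simp
  qed
  ultimately show bij: "bij ?D"
    by (simp add: bij_def)
  have "inv ?D \<in> bounded_ops"
    using bounded_ops_inv[OF D bij _ below] c by simp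
  moreover have "inv ?D \<circ> ?D = id" "?D \<circ> inv ?D = id"
    using bij by (simp_all add: bij_is_inj bij_is_surj flip: surj_iff)
  ultimately show "c \<notin> op_spectrum S"
    unfolding op_spectrum_def by blast
qed

text \<open>A lower bound for \<open>T\<close> makes the real part of the form
  \<open>cinner (T h) (T x)\<close> coercive. With \<open>T\<close> the identity this is the Riesz
  theorem; in general it yields surjectivity of T*T.\<close>

lemma bounded_below_represents:
  fixes T :: "'a::complex_hilbert \<Rightarrow> 'a" and \<phi> :: "'a \<Rightarrow> complex"
  assumes T: "T \<in> bounded_ops" and c: "0 < c" and below: "\<And>x. c * norm x \<le> norm (T x)"
    and \<phi>: "bounded_linear \<phi>" "\<And>a x. \<phi> (a *\<^sub>C x) = a * \<phi> x"
  obtains x where "\<And>h. cinner (T h) (T x) = \<phi> h"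
proof -
  have T': "bounded_linear T" by (rule bounded_opsD[OF T])
  obtain x where x: "\<And>h. Re (cinner (T h) (T x)) = Re (\<phi> h)"
  proof (rule coercive_form_represents[where B = "\<lambda>h x. Re (cinner (T h) (T x))"
        and c = "c\<^sup>2" and \<phi> = "\<lambda>h. Re (\<phi> h)"])
    show "bounded_bilinear (\<lambda>h x. Re (cinner (T h) (T x)))"
      by (rule bounded_bilinear.comp[OF bounded_bilinear_Re_cinner T' T'])
    show "Re (cinner (T h) (T x)) = Re (cinner (T x) (T h))" for h x
      by (subst cinner_commute) simp
    show "c\<^sup>2 * (norm x)\<^sup>2 \<le> Re (cinner (T x) (T x))" for x
      using power_mono[OF below[of x], of 2] c by (simp add: cinner_self power_mult_distrib)
    show "bounded_linear (\<lambda>h. Re (\<phi> h))"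
      by (intro bounded_linear_compose[OF bounded_linear_Re] \<phi>)
  qed (use c in auto)
  have "cinner (T h) (T x) = \<phi> h" for h
  proof (rule complex_eqI)
    \<comment> \<open>Both sides are complex linear in \<open>h\<close>, so the real identity at
      \<open>\<i> *\<^sub>C h\<close> gives the imaginary parts.\<close>
    show "Im (cinner (T h) (T x)) = Im (\<phi> h)"
      using x[of "\<i> *\<^sub>C h"] by (simp add: bounded_opsD(2)[OF T] cinner_scaleC_left \<phi>)
  qed (rule x)
  then show thesis by (rule that)
qed

text \<open>\<open>hadjoint\<close> is a definite description, so an adjoint has to be shown to
  exist; Riesz representation of \<open>\<lambda>h. cinner (T h) y\<close> provides it.\<close>

lemma cinner_hadjoint:
  assumes T: "T \<in> bounded_ops"
  shows "cinner (T x) y = cinner x (hadjoint T y)"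
proof -
  have "\<exists>z. \<forall>h. cinner h z = cinner (T h) y" for y
  proof (rule bounded_below_represents[of "\<lambda>x. x" 1 "\<lambda>h. cinner (T h) y"])
    show "bounded_linear (\<lambda>h. cinner (T h) y)"
      by (rule bounded_linear_compose[OF cinner.bounded_linear_left bounded_opsD(1)[OF T]])
  qed (auto simp: bounded_ops_id bounded_opsD(2)[OF T] cinner_scaleC_left)
  then obtain S where S: "\<And>h y. cinner h (S y) = cinner (T h) y"
    by metis
  have "hadjoint T = S"
    unfolding hadjoint_def
  proof (rule the_equality)
    show "\<forall>x y. cinner (T x) y = cinner x (S y)" by (simp add: S)
    show "R = S" if "\<forall>x y. cinner (T x) y = cinner x (R y)" for R
      using that S by (intro ext cinner_eqI) simp
  qed
  then show ?thesis by (simp add: S)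
qed

text \<open>Pairing with a fixed \<open>h\<close> reduces this to scalar power series, whose zeros
  are isolated.\<close>

lemma powser_vector_coeff_zero:
  fixes a :: "nat \<Rightarrow> 'a::complex_inner"
  assumes r: "0 < r" and sums: "\<And>z. cmod z < r \<Longrightarrow> (\<lambda>n. z ^ n *\<^sub>C a n) sums 0"
  shows "a n = 0"
proof (rule cinner_eqI)
  fix h
  have sums': "(\<lambda>n. cinner (a n) h * (z - 0) ^ n) sums 0" if "cmod (z - 0) < r" for z
    using bounded_linear.sums[OF cinner.bounded_linear_left[of h] sums[of z]] that
    by (simp add: cinner_scaleC_left mult.commute cinner.zero_left)
  have "cinner (a n) h = 0"
  proof (cases "n = 0")
    case True
    have "(\<lambda>n. cinner (a n) h * 0 ^ n) sums cinner (a 0) h"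
      by (rule powser_sums_zero)
    then show ?thesis
      using sums'[of 0] r True sums_unique2 by fastforce
  next
    case False
    show ?thesis
    proof (rule ccontr)
      assume nz: "cinner (a n) h \<noteq> 0"
      \<comment> \<open>The result on isolated zeros needs a nonzero coefficient of positive index,
        hence the case split. For the zero function its conclusion is absurd at the point
        \<open>s\<close>.\<close>
      obtain s where s: "0 < s" "\<And>z::complex. z \<in> cball 0 s - {0} \<Longrightarrow> (0::complex) \<noteq> 0"
        using powser_0_nonzero[where f = "\<lambda>_. 0", OF r sums' refl nz] False by auto
      show False
        using s(2)[of "complex_of_real s"] s(1) by simp
    qed
  qed
  then show "cinner h (a n) = cinner h 0"
    by (metis cinner_commute complex_cnj_zero cinner.zero_right)
qed

section \<open>Left-invertible operators\<close>

locale left_invertible_op =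
  fixes T :: "'a::complex_hilbert \<Rightarrow> 'a"
  assumes T: "T \<in> bounded_ops" and left_invertible: "left_invertible T"
begin

abbreviation "L \<equiv> left_inv T"
abbreviation "P \<equiv> proj_E T"

sublocale T: bounded_linear T
  by (rule bounded_opsD[OF T])

lemma bounded_below: obtains c where "0 < c" "\<And>x. c * norm x \<le> norm (T x)"
proof -
  obtain S where S: "S \<in> bounded_ops" "S \<circ> T = id"
    using left_invertible by (auto simp: left_invertible_def)
  obtain K where K: "0 < K" "\<And>x. norm (S x) \<le> norm x * K"
    using bounded_linear.pos_bounded[OF bounded_opsD(1)[OF S(1)]] by blast
  have "inverse K * norm x \<le> norm (T x)" for x
    using K(2)[of "T x"] K(1) fun_cong[OF S(2), of x] by (simp add: field_simps)
  then show thesis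
    using K(1) by (intro that[of "inverse K"]) auto
qed

lemma T_eq_iff: "T x = T y \<longleftrightarrow> x = y"
proof
  obtain c where c: "0 < c" "\<And>x. c * norm x \<le> norm (T x)"
    using bounded_below by blast
  assume "T x = T y"
  then have "c * norm (x - y) \<le> 0"
    using c(2)[of "x - y"] by (simp add: T.diff)
  then show "x = y"
    using c(1) by (simp add: mult_le_0_iff)
qed simp

lemma hadjoint_eq_iff: "hadjoint T y = z \<longleftrightarrow> (\<forall>h. cinner (T h) y = cinner h z)"
  using cinner_hadjoint[OF T] cinner_eqI by metis

lemma normal_op_eq_imp_eq:
  assumes "\<And>h. cinner (T h) (T x) = cinner (T h) (T y)"
  shows "x = y"
proof -
  have "cinner (T (x - y)) (T (x - y)) = 0"
    using assms[of "x - y"] by (simp add: T.diff cinner.diff_right)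
  then show ?thesis
    by (simp add: cinner_eq_zero_iff T.diff T_eq_iff)
qed

text \<open>Ensures that \<open>inv\<close> in the definition of \<open>left_inv\<close> is a true
  inverse.\<close>

lemma bij_normal_op: "bij (hadjoint T \<circ> T)"
proof (rule bijI)
  show "inj (hadjoint T \<circ> T)"
    by (rule injI) (metis comp_apply normal_op_eq_imp_eq cinner_hadjoint[OF T])
  show "surj (hadjoint T \<circ> T)"
    unfolding surj_def
  proof
    fix y
    obtain c where c: "0 < c" "\<And>x. c * norm x \<le> norm (T x)"
      using bounded_below by blast
    obtain x where "\<And>h. cinner (T h) (T x) = cinner h y"
      using bounded_below_represents[OF T c cinner.bounded_linear_left cinner_scaleC_left] by blast
    then have "hadjoint T (T x) = y"
      by (simp add: hadjoint_eq_iff)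
    then show "\<exists>x. y = (hadjoint T \<circ> T) x"
      by auto
  qed
qed

section \<open>The left inverse \<open>L\<close> and the projection \<open>P\<close>\<close>

lemma L_eq_iff: "L y = x \<longleftrightarrow> hadjoint T (T x) = hadjoint T y"
  unfolding left_inv_def using bij_normal_op by (metis bij_inv_eq_iff comp_apply)

text \<open>The hypothesis says that \<open>T x - y\<close> is orthogonal to the range of
  \<open>T\<close>, so \<open>L y\<close> is the least-squares solution. This replaces computations
  with the inverse of T*T.\<close>

lemma L_eqI: "(\<And>h. cinner (T h) (T x) = cinner (T h) y) \<Longrightarrow> L y = x"
  by (simp add: L_eq_iff hadjoint_eq_iff cinner_hadjoint[OF T, symmetric])

lemma cinner_T_L: "cinner (T h) (T (L y)) = cinner (T h) y"
  using L_eq_iff[of y "L y"] cinner_hadjoint[OF T] by metis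

lemma L_T: "L (T x) = x"
  by (simp add: L_eqI)

lemma L_bounded: "L \<in> bounded_ops"
proof -
  obtain c where c: "0 < c" "\<And>x. c * norm x \<le> norm (T x)"
    using bounded_below by blast
  have "bounded_linear L"
  proof (rule bounded_linear_intro[where K = "inverse c"])
    fix x y :: 'a and t :: real
    show "L (x + y) = L x + L y"
      by (intro L_eqI) (simp add: T.add cinner.add_right cinner_T_L)
    show "L (t *\<^sub>R x) = t *\<^sub>R L x"
      by (intro L_eqI) (simp add: T.scaleR cinner.scaleR_right cinner_T_L)
    \<comment> \<open>\<open>T \<circ> L\<close> is contractive, being an orthogonal projection; the
      lower bound for \<open>T\<close> then bounds \<open>L\<close>.\<close>
    have "(norm (T (L x)))\<^sup>2 = cmod (cinner (T (L x)) (T (L x)))"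
      by (simp add: cinner_self norm_power)
    also have "\<dots> \<le> norm (T (L x)) * norm x"
      unfolding cinner_T_L by (rule cinner_Cauchy_Schwarz)
    finally have "norm (T (L x)) \<le> norm x"
      by (cases "T (L x) = 0") (simp_all add: power2_eq_square)
    then have "c * norm (L x) \<le> norm x"
      using c(2)[of "L x"] by simp
    then show "norm (L x) \<le> norm x * inverse c"
      using c(1) by (simp add: field_simps)
  qed
  moreover have "L (a *\<^sub>C x) = a *\<^sub>C L x" for a x
    by (intro L_eqI) (simp add: bounded_opsD(2)[OF T] cinner_scaleC_right cinner_T_L)
  ultimately show ?thesis
    by (simp add: bounded_ops_def)
qed

sublocale L: bounded_linear L
  by (rule bounded_opsD[OF L_bounded])

lemma mem_ker_adj_iff: "x \<in> ker_adj T \<longleftrightarrow> (\<forall>h. cinner (T h) x = 0)"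
  by (simp add: ker_adj_def hadjoint_eq_iff cinner.zero_right)

text \<open>\<open>T \<circ> L\<close> projects onto the range of \<open>T\<close>, whose orthogonal
  complement is \<open>ker_adj T\<close>. The difference \<open>m\<close> of two candidates for the
  projection lies in \<open>ker_adj T\<close> and is orthogonal to itself.\<close>

lemma P_eq: "P x = x - T (L x)"
  unfolding proj_E_def orth_proj_def
proof (rule the_equality)
  show "x - T (L x) \<in> ker_adj T \<and> (\<forall>m\<in>ker_adj T. cinner (x - (x - T (L x))) m = 0)"
    by (simp add: mem_ker_adj_iff cinner.diff_right cinner_T_L)
next
  fix y assume y: "y \<in> ker_adj T \<and> (\<forall>m\<in>ker_adj T. cinner (x - y) m = 0)"
  define m where "m = x - T (L x) - y"
  have m: "m \<in> ker_adj T"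
    using y by (simp add: m_def mem_ker_adj_iff cinner.diff_right cinner_T_L)
  have "cinner m m = cinner (x - y) m - cinner (T (L x)) m"
    by (simp add: m_def cinner.diff_left)
  also have "\<dots> = 0"
    using y m by (simp add: mem_ker_adj_iff)
  finally show "y = x - T (L x)"
    by (simp add: cinner_eq_zero_iff m_def)
qed

lemma P_mem: "P x \<in> ker_adj T"
  by (simp add: P_eq mem_ker_adj_iff cinner.diff_right cinner_T_L)

lemma P_bounded: "P \<in> bounded_ops"
  unfolding P_eq[abs_def]
  by (intro bounded_ops_diff[OF bounded_ops_id] bounded_ops_comp[OF T L_bounded])

sublocale P: bounded_linear P
  by (rule bounded_opsD[OF P_bounded])

lemma P_T: "P (T x) = 0"
  by (simp add: P_eq L_T)

lemma L_ker_adj: "x \<in> ker_adj T \<Longrightarrow> L x = 0"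
  by (rule L_eqI) (simp add: mem_ker_adj_iff cinner.zero_right T.zero)

lemma L_pow_bounded: "L ^^ n \<in> bounded_ops"
  by (rule bounded_ops_funpow[OF L_bounded])

lemma L_pow_diff: "(L ^^ n) (x - y) = (L ^^ n) x - (L ^^ n) y"
  by (rule linear_diff[OF bounded_linear.linear[OF bounded_opsD(1)[OF L_pow_bounded]]])

section \<open>Growth of the coefficients and positivity of the model radius\<close>

lemma norm_P_L_pow_le:
  obtains C K where "0 < K" "\<And>n. norm (P ((L ^^ n) f)) \<le> C * K ^ n"
proof -
  obtain K where K: "0 < K" "\<And>x. norm (L x) \<le> norm x * K"
    using L.pos_bounded by blast
  obtain K' where K': "0 < K'" "\<And>x. norm (P x) \<le> norm x * K'"
    using P.pos_bounded by blast
  have pow: "norm ((L ^^ n) f) \<le> norm f * K ^ n" for n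
  proof (induction n)
    case (Suc n)
    have "norm ((L ^^ Suc n) f) \<le> norm ((L ^^ n) f) * K"
      using K(2)[of "(L ^^ n) f"] by simp
    also have "\<dots> \<le> norm f * K ^ n * K"
      using K(1) Suc by simp
    finally show ?case by (simp add: mult_ac)
  qed simp
  show thesis
  proof (rule that[OF K(1), of "norm f * K'"])
    fix n
    show "norm (P ((L ^^ n) f)) \<le> norm f * K' * K ^ n"
      using order_trans[OF K'(2)[of "(L ^^ n) f"] mult_right_mono[OF pow[of n], of K']] K'(1)
      by (simp add: mult_ac)
  qed
qed

text \<open>A vanishing coefficient means \<open>T (L x) = x\<close> at
  \<open>x = (L ^^ n) f\<close>, so each \<open>T\<close> undoes one \<open>L\<close>.\<close>

lemma T_pow_L_pow:
  assumes "\<And>n. P ((L ^^ n) f) = 0"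
  shows "(T ^^ n) ((L ^^ n) f) = f"
proof (induction n)
  case (Suc n)
  have "T (L ((L ^^ n) f)) = (L ^^ n) f"
    using assms[of n] by (simp add: P_eq)
  then show ?case
    using Suc by (simp add: funpow_swap1)
qed simp

text \<open>
  If \<open>e \<in> \<E>\<close> is nonzero and \<open>z\<close> is small, then \<open>v = (I - z T)\<^sup>-\<^sup>1 e\<close> satisfies \<open>L v = z v\<close>. So the
  spectrum of \<open>L\<close> contains nonzero points, and the model radius is not the junk value \<open>1 / 0 = 0\<close>.
\<close>

lemma model_radius_pos:
  assumes "e \<in> ker_adj T" "e \<noteq> 0"
  shows "0 < model_radius T"
proof -
  obtain K where K: "0 < K" "\<And>x. norm (T x) \<le> norm x * K"
    using T.pos_bounded by blast
  \<comment> \<open>Then \<open>cmod (inverse z) = 2 * K\<close> exceeds the bound \<open>K\<close>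
    for \<open>T\<close>, which makes \<open>v = z *\<^sub>C T v + e\<close> solvable.\<close>
  define z where "z = inverse (complex_of_real (2 * K))"
  have z: "z \<noteq> 0" "cmod z > 0"
    using K(1) by (simp_all add: z_def)
  have "bij (\<lambda>x. T x - inverse z *\<^sub>C x)"
  proof (rule bounded_ops_shift[OF T, of K])
    have "inverse z = complex_of_real (2 * K)"
      unfolding z_def by (rule inverse_inverse_eq)
    then show "K < cmod (inverse z)"
      using K(1) by (simp only: norm_of_real)
  qed (use K in \<open>auto simp: mult.commute\<close>)
  from surjD[OF bij_is_surj[OF this], of "- (inverse z *\<^sub>C e)"]
  obtain v where "- (inverse z *\<^sub>C e) = T v - inverse z *\<^sub>C v"
    by blast
  then have "inverse z *\<^sub>C v = T v + inverse z *\<^sub>C e"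
    by (simp add: algebra_simps)
  then have "z *\<^sub>C (inverse z *\<^sub>C v) = z *\<^sub>C (T v + inverse z *\<^sub>C e)"
    by simp
  then have v: "v = z *\<^sub>C T v + e"
    using z by (simp add: scaleC_scaleC scaleC_one scaleC_add_right)
  have "v \<noteq> 0"
  proof
    assume "v = 0"
    then have "z *\<^sub>C T v = 0"
      by (simp add: T.zero linear_0[OF bounded_linear.linear[OF bounded_linear_scaleC]])
    with v \<open>v = 0\<close> assms(2) show False
      by auto
  qed
  have "L v = L (z *\<^sub>C T v + e)"
    by (rule arg_cong[OF v])
  also have "\<dots> = z *\<^sub>C v"
    using assms(1) by (simp add: L.add bounded_opsD(2)[OF L_bounded] L_T L_ker_adj)
  finally have Lv: "L v - z *\<^sub>C v = 0"
    by simp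
  have z_spec: "z \<in> op_spectrum L"
    unfolding op_spectrum_def
  proof (intro CollectI notI)
    assume "\<exists>R\<in>bounded_ops. R \<circ> (\<lambda>x. L x - z *\<^sub>C x) = id \<and> (\<lambda>x. L x - z *\<^sub>C x) \<circ> R = id"
    then obtain R where R: "R \<circ> (\<lambda>x. L x - z *\<^sub>C x) = id"
      by blast
    have "R (L v - z *\<^sub>C v) = v" "R (L 0 - z *\<^sub>C 0) = 0"
      using fun_cong[OF R] by (simp_all del: L.zero)
    then show False
      using \<open>v \<noteq> 0\<close> by (simp add: Lv L.zero linear_0[OF bounded_linear.linear[OF bounded_linear_scaleC]])
  qed
  obtain K' where K': "0 < K'" "\<And>x. norm (L x) \<le> norm x * K'"
    using L.pos_bounded by blast
  \<comment> \<open>Without boundedness, \<open>Sup\<close> in \<open>spectral_radius\<close> would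
    carry no information.\<close>
  have "bdd_above (cmod ` op_spectrum L)"
  proof (rule bdd_aboveI2)
    show "cmod c \<le> K'" if "c \<in> op_spectrum L" for c
    proof (rule ccontr)
      assume "\<not> cmod c \<le> K'"
      then have "c \<notin> op_spectrum L"
        using K' by (intro bounded_ops_shift(2)[OF L_bounded, of K']) (auto simp: mult.commute)
      then show False using that by contradiction
    qed
  qed
  then have "cmod z \<le> spectral_radius L"
    unfolding spectral_radius_def by (intro cSup_upper imageI z_spec)
  with z(2) have "0 < spectral_radius L"
    by (rule less_le_trans)
  then show ?thesis
    by (simp add: model_radius_def)
qed

end

section \<open>The analytic model\<close>

locale analytic_left_invertible_op = left_invertible_op +
  assumes analytic: "analytic_op T" and nontrivial: "(UNIV :: 'a set) \<noteq> {0}"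
begin

lemma eq_zero_if_coeffs_zero:
  assumes "\<And>n. P ((L ^^ n) f) = 0"
  shows "f = 0"
proof -
  have "f \<in> range (T ^^ n)" for n
    using T_pow_L_pow[OF assms, of n] by (metis rangeI)
  then have "f \<in> (\<Inter>n. range (T ^^ n))"
    by blast
  then show ?thesis
    using analytic unfolding analytic_op_def by blast
qed

text \<open>A nonzero \<open>f\<close> has a nonzero coefficient, and this is a nonzero vector of
  \<open>ker_adj T\<close>.\<close>

lemma radius_pos: "0 < model_radius T"
proof -
  obtain f :: 'a where "f \<noteq> 0"
    using nontrivial by blast
  then obtain n where "P ((L ^^ n) f) \<noteq> 0"
    using eq_zero_if_coeffs_zero by blast
  then show ?thesis
    using P_mem model_radius_pos by blast
qed

text \<open>Some disc around 0 suffices for injectivity, so the crude bound on the coefficients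
  replaces the spectral radius formula.\<close>

lemma summable_coeffs:
  obtains r where "0 < r" "\<And>z. cmod z < r \<Longrightarrow> summable (\<lambda>n. z ^ n *\<^sub>C P ((L ^^ n) f))"
proof -
  obtain C K where K: "0 < K" "\<And>n. norm (P ((L ^^ n) f)) \<le> C * K ^ n"
    using norm_P_L_pow_le by blast
  have "summable (\<lambda>n. z ^ n *\<^sub>C P ((L ^^ n) f))" if z: "cmod z < inverse K" for z
  proof (rule summable_comparison_test'[where N = 0])
    have "cmod z * K < 1"
      using z K(1) by (simp add: field_simps)
    then show "summable (\<lambda>n. C * (cmod z * K) ^ n)"
      using K(1) by (intro summable_mult summable_geometric) (simp add: abs_mult)
    show "norm (z ^ n *\<^sub>C P ((L ^^ n) f)) \<le> C * (cmod z * K) ^ n" for n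
      using mult_left_mono[OF K(2)[of n], of "cmod z ^ n"]
      by (simp add: norm_scaleC norm_power power_mult_distrib mult_ac)
  qed
  then show thesis
    using K(1) by (intro that[of "inverse K"]) auto
qed

lemma inj_if_coeffs:
  assumes "\<And>n. P ((L ^^ n) f) = P ((L ^^ n) g)"
  shows "f = g"
  using eq_zero_if_coeffs_zero[of "f - g"] assms by (simp add: L_pow_diff P.diff)

lemma inj_model_U: "inj (model_U T)"
proof (rule injI)
  fix f g assume eq: "model_U T f = model_U T g"
  obtain r1 where r1: "0 < r1" "\<And>z. cmod z < r1 \<Longrightarrow> summable (\<lambda>n. z ^ n *\<^sub>C P ((L ^^ n) f))"
    using summable_coeffs by blast
  obtain r2 where r2: "0 < r2" "\<And>z. cmod z < r2 \<Longrightarrow> summable (\<lambda>n. z ^ n *\<^sub>C P ((L ^^ n) g))"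
    using summable_coeffs by blast
  \<comment> \<open>The comparison is confined to a disc where both series are known to converge, so
    that the infinite sums are genuine.\<close>
  define r where "r = min (model_radius T) (min r1 r2)"
  have "P ((L ^^ n) f) - P ((L ^^ n) g) = 0" for n
  proof (rule powser_vector_coeff_zero)
    show "0 < r"
      using r1 r2 radius_pos by (simp add: r_def)
    fix z assume z: "cmod z < r"
    have "(\<Sum>n. z ^ n *\<^sub>C P ((L ^^ n) f)) = (\<Sum>n. z ^ n *\<^sub>C P ((L ^^ n) g))"
      using fun_cong[OF eq, of z] z by (simp add: model_U_def r_def)
    moreover have "(\<lambda>n. z ^ n *\<^sub>C (P ((L ^^ n) f) - P ((L ^^ n) g))) sums
        ((\<Sum>n. z ^ n *\<^sub>C P ((L ^^ n) f)) - (\<Sum>n. z ^ n *\<^sub>C P ((L ^^ n) g)))"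
      unfolding scaleC_diff_right
      using r1(2)[of z] r2(2)[of z] z by (intro sums_diff summable_sums) (simp_all add: r_def)
    ultimately show "(\<lambda>n. z ^ n *\<^sub>C (P ((L ^^ n) f) - P ((L ^^ n) g))) sums 0"
      by simp
  qed
  then show "f = g"
    by (rule inj_if_coeffs[OF eq_iff_diff_eq_0[THEN iffD2]])
qed

text \<open>Once \<open>inv (model_U T)\<close> cancels, the defining condition on \<open>g'\<close>
  is \<open>cinner f g = cinner f g'\<close> for all \<open>f\<close>.\<close>

lemma model_U_adj_model_U: "model_U_adj T (model_U T g) = g"
  unfolding model_U_adj_def model_inner_def inv_f_f[OF inj_model_U]
  by (rule the_equality) (auto intro: cinner_eqI)

lemma taylor_coeff_model_U: "taylor_coeff T (model_U T f) n = P ((L ^^ n) f)"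
  by (simp add: taylor_coeff_def model_U_adj_model_U)

lemma taylor_coeff_model_U_eq_iff:
  "taylor_coeff T (model_U T f) = taylor_coeff T (model_U T g) \<longleftrightarrow> f = g"
  by (metis inj_if_coeffs taylor_coeff_model_U)

section \<open>Operators commuting with \<open>T\<close>\<close>

context
  fixes A :: "'a \<Rightarrow> 'a"
  assumes A: "A \<in> bounded_ops" and comm: "A \<circ> T = T \<circ> A"
begin

text \<open>Commutation enters here: \<open>A (T (L x)) = T (A (L x))\<close>.\<close>

lemma A_P: "A (P x) = A x - T (A (L x))"
  using fun_cong[OF comm, of "L x"] linear_diff[OF bounded_linear.linear[OF bounded_opsD(1)[OF A]]]
  by (simp add: P_eq)

text \<open>Fixing \<open>n\<close> and cutting the sum at \<open>m\<close> lets the induction add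
  one term at a time; \<open>m = n\<close> gives the full Cauchy product. The base case is
  \<open>P A P = P A\<close>, from \<open>P T = 0\<close>.\<close>

lemma telescoped_partial_convolution:
  assumes "m \<le> n"
  shows "(\<Sum>k\<le>m. P ((L ^^ k) (A (P ((L ^^ (n - k)) f))))) = P ((L ^^ m) (A ((L ^^ (n - m)) f)))"
  using assms
proof (induction m)
  case 0
  show ?case by (simp add: A_P P.diff P_T)
next
  case (Suc m)
  have "n - m = Suc (n - Suc m)"
    using Suc.prems by simp
  then have "L ((L ^^ (n - Suc m)) f) = (L ^^ (n - m)) f"
    by simp
  \<comment> \<open>One \<open>L\<close> cancels the \<open>T\<close> from \<open>A_P\<close>, and
    the subtracted term is exactly the partial sum up to \<open>m\<close>.\<close>
  then have "P ((L ^^ Suc m) (A (P ((L ^^ (n - Suc m)) f)))) =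
      P ((L ^^ Suc m) (A ((L ^^ (n - Suc m)) f))) - P ((L ^^ m) (A ((L ^^ (n - m)) f)))"
    by (simp only: A_P L_pow_diff L.diff P.diff funpow_Suc_right o_apply L_T)
  then show ?case
    using Suc by simp
qed

text \<open>Taylor coefficients lie in \<open>ker_adj T\<close>, so the symbol is never evaluated
  where it is \<open>undefined\<close>.\<close>

lemma conv_commutant_symbol:
  "conv (commutant_symbol T A) (taylor_coeff T (model_U T f)) = taylor_coeff T (model_U T (A f))"
proof
  fix n
  show "conv (commutant_symbol T A) (taylor_coeff T (model_U T f)) n =
      taylor_coeff T (model_U T (A f)) n"
    using telescoped_partial_convolution[of n n f]
    by (simp add: conv_def taylor_coeff_model_U commutant_symbol_def P_mem)
qed

lemma commutant_symbol_bounded: "commutant_symbol T A m \<in> bounded_ops_on (ker_adj T)"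
proof -
  have S: "(\<lambda>x. P ((L ^^ m) (A x))) \<in> bounded_ops"
    by (intro bounded_ops_comp[OF P_bounded] bounded_ops_comp[OF L_pow_bounded] A)
  interpret S: bounded_linear "\<lambda>x. P ((L ^^ m) (A x))"
    by (rule bounded_opsD[OF S])
  obtain K where K: "\<And>x. norm (P ((L ^^ m) (A x))) \<le> K * norm x"
    using S.bounded by (auto simp: mult.commute)
  \<comment> \<open>Needed to unfold the restricted symbol at sums and multiples.\<close>
  have "x + y \<in> ker_adj T" "c *\<^sub>C x \<in> ker_adj T"
    if "x \<in> ker_adj T" "y \<in> ker_adj T" for x y c
    using that by (auto simp: mem_ker_adj_iff cinner.add_right cinner_scaleC_right)
  then show ?thesis
    unfolding bounded_ops_on_def commutant_symbol_def
    by (auto simp: P_mem S.add bounded_opsD(2)[OF S] intro!: exI[of _ K] K)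
qed

text \<open>The definite description is settled because Taylor coefficients determine an element of
  the model space.\<close>

lemma mult_op_commutant_symbol: "mult_op T (commutant_symbol T A) (model_U T f) = model_U T (A f)"
  unfolding mult_op_def conv_commutant_symbol
  by (rule the_equality) (auto simp: model_space_def taylor_coeff_model_U_eq_iff)

lemma commutant_symbol_multiplier: "commutant_symbol T A \<in> generalized_multipliers T"
  using commutant_symbol_bounded conv_commutant_symbol
  by (auto simp: generalized_multipliers_def mult_dom_def model_space_def)

end

end

theorem theorem4:
  fixes T A :: "'a::complex_hilbert \<Rightarrow> 'a"
  assumes "(UNIV :: 'a set) \<noteq> {0}"
    and "T \<in> bounded_ops"
    and "left_invertible T"
    and "analytic_op T"
    and "A \<in> bounded_ops"
    and "A \<circ> T = T \<circ> A"
  shows "commutant_symbol T A \<in> generalized_multipliers T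
    \<and> A = model_U_adj T \<circ> mult_op T (commutant_symbol T A) \<circ> model_U T"
proof -
  interpret analytic_left_invertible_op T
    using assms by unfold_locales
  show ?thesis
    by (simp add: commutant_symbol_multiplier[OF assms(5,6)] mult_op_commutant_symbol[OF assms(5,6)]
        model_U_adj_model_U o_def)
qed

end
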